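(* Let $\{F^{ij}\}_{1\le i<j\le 4}$ be a sextuple of real fundamental matrices such that, for each $i\in\{1,2,3,4\}$, the three epipoles $e_i^j$ ($j\neq i$) in the $i$-th image do not lie on a line in $\mathbb{P}^2$. Then $\{F^{ij}\}$ is compatible if and only if the triple-wise conditions hold for every three distinct indices in $\{1,2,3,4\}$ and $$\mathbf{e}_{4123}\,\mathbf{e}_{2134}\,\mathbf{e}_{3142}\,\mathbf{e}_{4231}\,\mathbf{e}_{1243}\,\mathbf{e}_{2341}=\mathbf{e}_{3124}\,\mathbf{e}_{4132}\,\mathbf{e}_{2143}\,\mathbf{e}_{1234}\,\mathbf{e}_{3241}\,\mathbf{e}_{1342},$$ where $\mathbf{e}_{sijt}:=(e_i^s)^TF^{ij}e_j^t$.
   Context: Everything is over $\mathbb{R}$. A camera is a rank-3 real $3\times 4$ matrix (up to nonzero scale); its center is its kernel, a point of $\mathbb{P}^3$. A fundamental matrix is a rank-2 real $3\times 3$ matrix (up to nonzero scale). For $3\times 4$ matrices $P_1,P_2$, $\psi(P_1,P_2)$ is the $3\times3$ matrix $F$ (up to scale) with $\det\begin{bmatrix}P_1&x&0\\P_2&0&y\end{bmatrix}=x^TFy$ for all $x,y\in\mathbb{R}^3$. Affine representatives of the fundamental matrices are fixed with $F^{ji}=(F^{ij})^T$. A set $\{F^{ij}\}$ is compatible if there are cameras $P_1,\dots,P_n$ with $F^{ij}=\psi(P_i,P_j)$ up to nonzero scale for all given $(i,j)$; such cameras are called a solution. The epipole $e_j^i\in\mathbb{R}^3$ (the $i$-th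 epipole in the $j$-th image) is a fixed nonzero vector spanning $\ker F^{ij}$; equalities between epipoles are up to nonzero scale. The triple-wise conditions for three distinct indices $i,j,k$: either (non-collinear) the two epipoles in each of the three images are distinct, i.e. $e_i^j\ne e_i^k$, $e_j^i\neq e_j^k$, $e_k^i\ne e_k^j$, and $(e_i^k)^TF^{ij}e_j^k=(e_i^j)^TF^{ik}e_k^j=(e_j^i)^TF^{jk}e_k^i=0$; or (collinear) $e_i^j=e_i^k$, $e_j^i=e_j^k$, $e_k^i=e_k^j$ and $(F^{ij})^T[e_i^j]_\times F^{ik}=F^{jk}$ up to nonzero scale, where $[t]_\times$ is the skew-symmetric matrix with $[t]_\times u=t\times u$. *)

theory Defs
  imports "HOL-Analysis.Analysis"
begin

text \<open>Points of projective space and matrices up to scale are handled through nonzero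
  representatives, compared by the following relation.\<close>

definition proj_eq :: "'a::real_vector \<Rightarrow> 'a \<Rightarrow> bool"
  where "proj_eq a b \<longleftrightarrow> (\<exists>c. c \<noteq> 0 \<and> a = c *\<^sub>R b)"

text \<open>A line in the projective plane is the projectivization of a plane through the origin.\<close>

definition on_proj_line :: "(real^3) set \<Rightarrow> bool"
  where "on_proj_line S \<longleftrightarrow> (\<exists>L. subspace L \<and> dim L = 2 \<and> S \<subseteq> L)"

definition camera :: "real^4^3 \<Rightarrow> bool"
  where "camera P \<longleftrightarrow> rank P = 3"

definition fundamental :: "real^3^3 \<Rightarrow> bool"
  where "fundamental F \<longleftrightarrow> rank F = 2"

text \<open>The block matrix with block rows \<open>P x 0\<close> and \<open>Q 0 y\<close>.\<close>

definition joint_matrix :: "real^4^3 \<Rightarrow> real^4^3 \<Rightarrow> real^3 \<Rightarrow> real^3 \<Rightarrow> real^6^6"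
  where "joint_matrix P Q x y = vector
    (map (\<lambda>k. vector [P $ k $ 1, P $ k $ 2, P $ k $ 3, P $ k $ 4, x $ k, 0]) [1, 2, 3] @
     map (\<lambda>k. vector [Q $ k $ 1, Q $ k $ 2, Q $ k $ 3, Q $ k $ 4, 0, y $ k]) [1, 2, 3])"

definition psi :: "real^4^3 \<Rightarrow> real^4^3 \<Rightarrow> real^3^3"
  where "psi P Q = (THE F. \<forall>x y. det (joint_matrix P Q x y) = x \<bullet> (F *v y))"

text \<open>The matrix in the definition of \<open>psi\<close> exists and is unique.\<close>

lemma forall_6: "(\<forall>i::6. R i) \<longleftrightarrow> R 1 \<and> R 2 \<and> R 3 \<and> R 4 \<and> R 5 \<and> R 6"
proof -
  have "i = 1 \<or> i = 2 \<or> i = 3 \<or> i = 4 \<or> i = 5 \<or> i = 6" for i :: 6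
  proof (induct i)
    case (of_int z)
    then have "z = 0 \<or> z = 1 \<or> z = 2 \<or> z = 3 \<or> z = 4 \<or> z = 5" by auto
    then show ?case by auto
  qed
  then show ?thesis by metis
qed

lemma vector_6 [simp]:
  "(vector [a, b, c, d, u, v] :: 'a::zero^6) $ 1 = a"
  "(vector [a, b, c, d, u, v] :: 'a^6) $ 2 = b"
  "(vector [a, b, c, d, u, v] :: 'a^6) $ 3 = c"
  "(vector [a, b, c, d, u, v] :: 'a^6) $ 4 = d"
  "(vector [a, b, c, d, u, v] :: 'a^6) $ 5 = u"
  "(vector [a, b, c, d, u, v] :: 'a^6) $ 6 = v"
  unfolding vector_def by simp_all

lemma transpose_joint_matrix_left:
  "transpose (joint_matrix P Q x y) =
    (\<chi> i. if i = 5 then vector [x $ 1, x $ 2, x $ 3, 0, 0, 0]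
      else transpose (joint_matrix P Q 0 y) $ i)"
  by (simp add: vec_eq_iff forall_6 joint_matrix_def transpose_def)

lemma transpose_joint_matrix_right:
  "transpose (joint_matrix P Q x y) =
    (\<chi> i. if i = 6 then vector [0, 0, 0, y $ 1, y $ 2, y $ 3]
      else transpose (joint_matrix P Q x 0) $ i)"
  by (simp add: vec_eq_iff forall_6 joint_matrix_def transpose_def)

lemma linear_det_joint_matrix_left: "linear (\<lambda>x. det (joint_matrix P Q x y))"
proof -
  define v :: "real^3 \<Rightarrow> real^6" where "v = (\<lambda>x. vector [x $ 1, x $ 2, x $ 3, 0, 0, 0])"
  define T where "T = (\<lambda>i. transpose (joint_matrix P Q 0 y) $ i)"
  have D: "det (joint_matrix P Q x y) = det (\<chi> i. if i = 5 then v x else T i)" for x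
    by (metis (no_types) transpose_joint_matrix_left det_transpose v_def T_def)
  have "v (a + b) = v a + v b" "v (c *\<^sub>R a) = c *s v a" for a b c
    by (simp_all add: v_def vec_eq_iff forall_6)
  then show ?thesis
    unfolding D by (intro linearI) (simp_all only: det_row_add det_row_mul real_scaleR_def)
qed

lemma linear_det_joint_matrix_right: "linear (\<lambda>y. det (joint_matrix P Q x y))"
proof -
  define v :: "real^3 \<Rightarrow> real^6" where "v = (\<lambda>y. vector [0, 0, 0, y $ 1, y $ 2, y $ 3])"
  define T where "T = (\<lambda>i. transpose (joint_matrix P Q x 0) $ i)"
  have D: "det (joint_matrix P Q x y) = det (\<chi> i. if i = 6 then v y else T i)" for y
    by (metis (no_types) transpose_joint_matrix_right det_transpose v_def T_def)
  have "v (a + b) = v a + v b" "v (c *\<^sub>R a) = c *s v a" for a b c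
    by (simp_all add: v_def vec_eq_iff forall_6)
  then show ?thesis
    unfolding D by (intro linearI) (simp_all only: det_row_add det_row_mul real_scaleR_def)
qed

lemma ex1_psi: "\<exists>!F. \<forall>x y. det (joint_matrix P Q x y) = x \<bullet> (F *v y)"
proof -
  define B where "B = (\<lambda>x y. det (joint_matrix P Q x y))"
  define F :: "real^3^3" where "F = (\<chi> i j. B (axis i 1) (axis j 1))"
  have linx: "linear (\<lambda>x. B x y)" for y
    unfolding B_def by (rule linear_det_joint_matrix_left)
  have liny: "linear (\<lambda>y. B x y)" for x
    unfolding B_def by (rule linear_det_joint_matrix_right)
  have expand: "f x = (\<Sum>i\<in>UNIV. x $ i * f (axis i 1))" if "linear f"
    for f :: "real^3 \<Rightarrow> real" and x
  proof -
    have "f x = f (\<Sum>i\<in>UNIV. (x $ i) *\<^sub>R axis i 1)"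
      using basis_expansion[of x] by (simp add: scalar_mult_eq_scaleR)
    also have "\<dots> = (\<Sum>i\<in>UNIV. x $ i * f (axis i 1))"
      using that by (simp add: linear_sum linear_cmul)
    finally show ?thesis .
  qed
  have *: "B x y = x \<bullet> (F *v y)" for x y
  proof -
    have "B x y = (\<Sum>i\<in>UNIV. x $ i * B (axis i 1) y)"
      by (rule expand[OF linx])
    also have "\<dots> = (\<Sum>i\<in>UNIV. x $ i * (\<Sum>j\<in>UNIV. y $ j * B (axis i 1) (axis j 1)))"
      by (subst expand[OF liny]) (rule refl)
    finally show ?thesis
      by (simp add: F_def inner_vec_def matrix_vector_mult_def mult.commute)
  qed
  show ?thesis
  proof (rule ex1I[of _ F])
    show "\<forall>x y. det (joint_matrix P Q x y) = x \<bullet> (F *v y)"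
      using * by (simp add: B_def)
  next
    fix G :: "real^3^3"
    assume "\<forall>x y. det (joint_matrix P Q x y) = x \<bullet> (G *v y)"
    then have "x \<bullet> (G *v y) = x \<bullet> (F *v y)" for x y
      using * by (simp add: B_def)
    then have "G *v y = F *v y" for y
      by (metis vector_eq_ldot)
    then show "G = F"
      by (simp add: matrix_eq)
  qed
qed

lemma psi: "det (joint_matrix P Q x y) = x \<bullet> (psi P Q *v y)"
  using theI'[OF ex1_psi[of P Q]] unfolding psi_def by blast

definition compatible :: "nat \<Rightarrow> (nat \<Rightarrow> nat \<Rightarrow> real^3^3) \<Rightarrow> bool"
  where "compatible n F \<longleftrightarrow> (\<exists>P. (\<forall>i\<in>{1..n}. camera (P i)) \<and>
    (\<forall>i\<in>{1..n}. \<forall>j\<in>{1..n}. i < j \<longrightarrow> proj_eq (F i j) (psi (P i) (P j))))"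

text \<open>For a family \<open>e\<close> of epipoles, \<open>e i j\<close> is the \<open>j\<close>-th epipole in the \<open>i\<close>-th image: the
  subscript (image) comes first, and \<open>e i j\<close> spans the kernel of \<open>F j i\<close>.\<close>

definition is_epipole :: "real^3^3 \<Rightarrow> real^3 \<Rightarrow> bool"
  where "is_epipole F v \<longleftrightarrow> v \<noteq> 0 \<and> {u. F *v u = 0} = span {v}"

definition skew :: "real^3 \<Rightarrow> real^3^3"
  where "skew t = matrix (cross3 t)"

definition triple_noncollinear ::
    "(nat \<Rightarrow> nat \<Rightarrow> real^3^3) \<Rightarrow> (nat \<Rightarrow> nat \<Rightarrow> real^3) \<Rightarrow> nat \<Rightarrow> nat \<Rightarrow> nat \<Rightarrow> bool"
  where "triple_noncollinear F e i j k \<longleftrightarrow>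
    \<not> proj_eq (e i j) (e i k) \<and> \<not> proj_eq (e j i) (e j k) \<and> \<not> proj_eq (e k i) (e k j) \<and>
    e i k \<bullet> (F i j *v e j k) = 0 \<and>
    e i j \<bullet> (F i k *v e k j) = 0 \<and>
    e j i \<bullet> (F j k *v e k i) = 0"

definition triple_collinear ::
    "(nat \<Rightarrow> nat \<Rightarrow> real^3^3) \<Rightarrow> (nat \<Rightarrow> nat \<Rightarrow> real^3) \<Rightarrow> nat \<Rightarrow> nat \<Rightarrow> nat \<Rightarrow> bool"
  where "triple_collinear F e i j k \<longleftrightarrow>
    proj_eq (e i j) (e i k) \<and> proj_eq (e j i) (e j k) \<and> proj_eq (e k i) (e k j) \<and>
    proj_eq (transpose (F i j) ** skew (e i j) ** F i k) (F j k)"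

definition triple_wise ::
    "(nat \<Rightarrow> nat \<Rightarrow> real^3^3) \<Rightarrow> (nat \<Rightarrow> nat \<Rightarrow> real^3) \<Rightarrow> nat \<Rightarrow> nat \<Rightarrow> nat \<Rightarrow> bool"
  where "triple_wise F e i j k \<longleftrightarrow> triple_noncollinear F e i j k \<or> triple_collinear F e i j k"

text \<open>\<open>epi F e s i j t\<close> is the number \<open>e\<^sub>s\<^sub>i\<^sub>j\<^sub>t\<close>.\<close>

definition epi ::
    "(nat \<Rightarrow> nat \<Rightarrow> real^3^3) \<Rightarrow> (nat \<Rightarrow> nat \<Rightarrow> real^3) \<Rightarrow> nat \<Rightarrow> nat \<Rightarrow> nat \<Rightarrow> nat \<Rightarrow> real"
  where "epi F e s i j t = e i s \<bullet> (F i j *v e j t)"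

end

theory Submission
  imports Defs
begin

text \<open>For cameras \<open>P\<close> and \<open>Q\<close> with distinct centers, \<open>psi P Q\<close> is, up to scale, the only nonzero \<open>F\<close>
  such that \<open>P\<^sup>T F Q\<close> is skew-symmetric. Since no three epipoles are collinear, the centers of a
  solution form a basis of \<open>real^4\<close>, and in that basis \<open>P\<^sub>i\<close> has columns \<open>\<mu>\<^sub>i\<^sub>k e\<^sub>i\<^sup>k\<close> for
  \<open>k \<noteq> i\<close> and \<open>0\<close> for \<open>k = i\<close>. Skew-symmetry then amounts to the triple-wise conditions and, for
  each \<open>{i, j, s, t} = {1, 2, 3, 4}\<close>, the equation
  \<open>\<mu>\<^sub>i\<^sub>s \<mu>\<^sub>j\<^sub>t e\<^sub>s\<^sub>i\<^sub>j\<^sub>t = - \<mu>\<^sub>i\<^sub>t \<mu>\<^sub>j\<^sub>s e\<^sub>t\<^sub>i\<^sub>j\<^sub>s\<close>. In the product of these six equations all the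
  scale factors cancel, which leaves the displayed identity; conversely, after normalizing
  \<open>\<mu>\<^sub>1\<^sub>k = \<mu>\<^sub>k\<^sub>1 = 1\<close>, the remaining six unknowns are linked in a cycle that closes up precisely
  under that identity.\<close>

section \<open>Determinants of the joint matrix and basic properties of \<open>psi\<close>\<close>

lemma sum_6: "sum f (UNIV::6 set) = f 1 + f 2 + f 3 + f 4 + f 5 + f 6"
proof -
  have *: "(UNIV :: 6 set) = {1, 2, 3, 4, 5, 6}"
    using forall_6[of "\<lambda>i. i \<in> {1, 2, 3, 4, 5, 6}"] by auto
  show ?thesis unfolding * by (simp add: add_ac)
qed

lemma joint_matrix_mult:
  fixes u :: "real^4"
  shows "joint_matrix P Q x y *v vector [u $ 1, u $ 2, u $ 3, u $ 4, a, b] =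
    vector [(P *v u + a *\<^sub>R x) $ 1, (P *v u + a *\<^sub>R x) $ 2, (P *v u + a *\<^sub>R x) $ 3,
      (Q *v u + b *\<^sub>R y) $ 1, (Q *v u + b *\<^sub>R y) $ 2, (Q *v u + b *\<^sub>R y) $ 3]"
  by (simp add: vec_eq_iff forall_6 joint_matrix_def matrix_vector_mult_def sum_6 sum_4 algebra_simps)

text \<open>By block multiplication, \<open>(u, a, b)\<close> is a nonzero kernel vector of the
  joint matrix.\<close>

lemma det_joint_matrix_eq_0:
  fixes u :: "real^4"
  assumes "P *v u + a *\<^sub>R x = 0" "Q *v u + b *\<^sub>R y = 0" "u \<noteq> 0 \<or> a \<noteq> 0 \<or> b \<noteq> 0"
  shows "det (joint_matrix P Q x y) = 0"
proof -
  have "joint_matrix P Q x y *v vector [u $ 1, u $ 2, u $ 3, u $ 4, a, b] = 0"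
    unfolding joint_matrix_mult assms(1,2) by (simp add: vec_eq_iff forall_6)
  moreover have "(vector [u $ 1, u $ 2, u $ 3, u $ 4, a, b] :: real^6) \<noteq> 0"
    using assms(3) by (auto simp: vec_eq_iff forall_6 forall_4)
  ultimately show ?thesis
    by (metis invertible_det_nz invertible_left_inverse matrix_left_invertible_ker)
qed

text \<open>The images \<open>P *v u\<close> and \<open>Q *v u\<close> of one point satisfy the
  epipolar constraint, by the kernel vector \<open>(u, -1, -1)\<close>. So the form is alternating,
  and polarization makes it skew.\<close>

lemma psi_skew:
  "(P *v v) \<bullet> (psi P Q *v (Q *v w)) = - ((P *v w) \<bullet> (psi P Q *v (Q *v v)))"
proof -
  have alt: "(P *v u) \<bullet> (psi P Q *v (Q *v u)) = 0" for u
    unfolding psi[symmetric] by (rule det_joint_matrix_eq_0[of _ u "-1" _ _ "-1"]) auto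
  show ?thesis
    using alt[of "v + w"] alt[of v] alt[of w]
    by (simp add: matrix_vector_right_distrib inner_add_left inner_add_right)
qed

text \<open>A common center \<open>c\<close> gives the kernel vector \<open>(c, 0, 0)\<close> for
  all \<open>x\<close> and \<open>y\<close>. This separates the centers of a solution.\<close>

lemma psi_eq_0:
  assumes "P *v c = 0" "Q *v c = 0" "c \<noteq> 0"
  shows "psi P Q = 0"
proof -
  have "x \<bullet> (psi P Q *v y) = 0" for x y
    unfolding psi[symmetric] using assms by (intro det_joint_matrix_eq_0[of _ c 0 _ _ 0]) auto
  then have "psi P Q *v y = 0" for y
    by (metis inner_eq_zero_iff)
  then show ?thesis by (simp add: matrix_eq)
qed

text \<open>A left kernel vector splits into blocks \<open>p\<close> and \<open>q\<close>; pairing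
  it with the images of \<open>(u, 0, 0)\<close>, \<open>(0, 1, 0)\<close> and
  \<open>(0, 0, 1)\<close> gives the three equations.\<close>

lemma joint_matrix_vector_mult:
  fixes u :: "real^4" and z :: "real^6"
  defines "p \<equiv> vector [z $ 1, z $ 2, z $ 3]" and "q \<equiv> vector [z $ 4, z $ 5, z $ 6]"
  assumes "z v* joint_matrix P Q x y = 0"
  shows "p \<bullet> (P *v u) + q \<bullet> (Q *v u) = 0" "p \<bullet> x = 0" "q \<bullet> y = 0"
proof -
  have z: "(z v* joint_matrix P Q x y) \<bullet> w = 0" for w
    using assms(3) by simp
  then have w: "z \<bullet> (joint_matrix P Q x y *v w) = 0" for w
    by (metis dot_lmul_matrix)
  show "p \<bullet> (P *v u) + q \<bullet> (Q *v u) = 0"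
    using w[of "vector [u $ 1, u $ 2, u $ 3, u $ 4, 0, 0]"] unfolding joint_matrix_mult
    by (simp add: inner_vec_def sum_6 sum_3 p_def q_def)
  show "p \<bullet> x = 0"
    using w[of "vector [(0::real^4) $ 1, (0::real^4) $ 2, (0::real^4) $ 3, (0::real^4) $ 4, 1, 0]"]
    unfolding joint_matrix_mult
    by (simp add: inner_vec_def sum_6 sum_3 p_def q_def)
  show "q \<bullet> y = 0"
    using w[of "vector [(0::real^4) $ 1, (0::real^4) $ 2, (0::real^4) $ 3, (0::real^4) $ 4, 0, 1]"]
    unfolding joint_matrix_mult
    by (simp add: inner_vec_def sum_6 sum_3 p_def q_def)
qed

text \<open>The form does not vanish at \<open>(cs, ct)\<close>: in a left kernel vector,
  \<open>p\<close> kills \<open>P *v cs\<close> and \<open>q\<close> kills \<open>Q *v ct\<close>.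
  The relation between \<open>p\<close> and \<open>q\<close> at \<open>cj\<close> and
  \<open>ct\<close> then forces \<open>p = 0\<close>, and at \<open>ci\<close> and \<open>cs\<close>
  it forces \<open>q = 0\<close>.\<close>

lemma psi_nonzero:
  fixes ci cj cs ct :: "real^4"
  assumes "P *v ci = 0" "Q *v cj = 0"
    and P: "\<And>x. x \<bullet> (P *v cj) = 0 \<Longrightarrow> x \<bullet> (P *v cs) = 0 \<Longrightarrow> x \<bullet> (P *v ct) = 0 \<Longrightarrow> x = 0"
    and Q: "\<And>x. x \<bullet> (Q *v ci) = 0 \<Longrightarrow> x \<bullet> (Q *v cs) = 0 \<Longrightarrow> x \<bullet> (Q *v ct) = 0 \<Longrightarrow> x = 0"
  shows "psi P Q \<noteq> 0"
proof
  assume "psi P Q = 0"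
  then have "det (joint_matrix P Q (P *v cs) (Q *v ct)) = 0"
    by (simp add: psi)
  then have "\<not> invertible (transpose (joint_matrix P Q (P *v cs) (Q *v ct)))"
    by (simp add: invertible_det_nz det_transpose)
  then obtain z where "z \<noteq> 0" and z: "z v* joint_matrix P Q (P *v cs) (Q *v ct) = 0"
    by (metis invertible_left_inverse matrix_left_invertible_ker transpose_matrix_vector)
  define p q :: "real^3" where "p = vector [z $ 1, z $ 2, z $ 3]" and "q = vector [z $ 4, z $ 5, z $ 6]"
  note * = joint_matrix_vector_mult[OF z, folded p_def q_def]
  have "p = 0"
    using *(1)[of cj] *(1)[of cs] *(1)[of ct] *(2,3) assms(2) by (intro P) auto
  moreover have "q = 0"
    using *(1)[of ci] *(1)[of cs] *(1)[of ct] *(2,3) assms(1) by (intro Q) auto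
  ultimately have "z = 0"
    by (simp add: p_def q_def vec_eq_iff forall_6 forall_3)
  with \<open>z \<noteq> 0\<close> show False ..
qed

section \<open>Skew forms and uniqueness up to scale\<close>

text \<open>A skew form on \<open>real^4\<close> with \<open>ci\<close> and \<open>cj\<close> in its radical is determined by its value
  at \<open>(cs, ct)\<close>.\<close>

lemma skew_form_eq_0:
  fixes ci cj cs ct :: "real^4" and H :: "real^3^3"
  assumes skew: "\<And>v w. v \<in> {ci, cj, cs, ct} \<Longrightarrow> w \<in> {ci, cj, cs, ct} \<Longrightarrow>
      (P *v v) \<bullet> (H *v (Q *v w)) = - ((P *v w) \<bullet> (H *v (Q *v v)))"
    and "P *v ci = 0" "Q *v cj = 0"
    and P: "\<And>x. x \<bullet> (P *v cj) = 0 \<Longrightarrow> x \<bullet> (P *v cs) = 0 \<Longrightarrow> x \<bullet> (P *v ct) = 0 \<Longrightarrow> x = 0"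
    and Q: "\<And>x. x \<bullet> (Q *v ci) = 0 \<Longrightarrow> x \<bullet> (Q *v cs) = 0 \<Longrightarrow> x \<bullet> (Q *v ct) = 0 \<Longrightarrow> x = 0"
    and "(P *v cs) \<bullet> (H *v (Q *v ct)) = 0"
  shows "H = 0"
proof -
  \<comment> \<open>Against \<open>P *v cj\<close> skewness moves the form onto
    \<open>Q *v cj = 0\<close>. The other pairings vanish since \<open>P *v ci = 0\<close>, by
    skewness on the diagonal, or by the assumed zero at \<open>(cs, ct)\<close>.\<close>
  have H: "H *v (Q *v w) = 0" if "w \<in> {ci, cs, ct}" for w
    using that skew[of cj w] skew[of cs w] skew[of ct w] skew[of ci w] assms(2,3,6) skew[of ct cs]
      skew[of cj ci]
    by (intro P) (auto simp: inner_commute)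
  have "x v* H = 0" for x
    by (intro Q) (simp_all add: dot_lmul_matrix H)
  then have "x \<bullet> (H *v y) = 0" for x y
    by (metis dot_lmul_matrix inner_zero_left)
  then have "H *v y = 0" for y
    by (metis inner_eq_zero_iff)
  then show ?thesis by (simp add: matrix_eq)
qed

text \<open>One value determines such a form, and neither \<open>F\<close> nor
  \<open>psi P Q\<close> vanishes at \<open>(cs, ct)\<close>. Subtracting the multiple of
  \<open>psi P Q\<close> with the same value there leaves zero.\<close>

lemma skew_form_proj_eq_psi:
  fixes ci cj cs ct :: "real^4" and F :: "real^3^3"
  assumes skew: "\<And>v w. v \<in> {ci, cj, cs, ct} \<Longrightarrow> w \<in> {ci, cj, cs, ct} \<Longrightarrow>
      (P *v v) \<bullet> (F *v (Q *v w)) = - ((P *v w) \<bullet> (F *v (Q *v v)))"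
    and ker: "P *v ci = 0" "Q *v cj = 0"
    and P: "\<And>x. x \<bullet> (P *v cj) = 0 \<Longrightarrow> x \<bullet> (P *v cs) = 0 \<Longrightarrow> x \<bullet> (P *v ct) = 0 \<Longrightarrow> x = 0"
    and Q: "\<And>x. x \<bullet> (Q *v ci) = 0 \<Longrightarrow> x \<bullet> (Q *v cs) = 0 \<Longrightarrow> x \<bullet> (Q *v ct) = 0 \<Longrightarrow> x = 0"
    and "F \<noteq> 0"
  shows "proj_eq F (psi P Q)"
proof -
  define p where "p = (P *v cs) \<bullet> (F *v (Q *v ct))"
  define q where "q = (P *v cs) \<bullet> (psi P Q *v (Q *v ct))"
  have "p \<noteq> 0"
    using skew_form_eq_0[OF skew ker P Q] \<open>F \<noteq> 0\<close> by (auto simp: p_def)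
  moreover have "q \<noteq> 0"
    using skew_form_eq_0[OF psi_skew ker P Q] psi_nonzero[OF ker P Q] by (auto simp: q_def)
  moreover have "F - (p / q) *\<^sub>R psi P Q = 0"
  proof (rule skew_form_eq_0[OF _ ker P Q])
    fix v w assume "v \<in> {ci, cj, cs, ct}" "w \<in> {ci, cj, cs, ct}"
    then show "(P *v v) \<bullet> ((F - (p / q) *\<^sub>R psi P Q) *v (Q *v w)) =
        - ((P *v w) \<bullet> ((F - (p / q) *\<^sub>R psi P Q) *v (Q *v v)))"
      using skew[of v w] psi_skew[of P v Q w]
      by (simp add: matrix_vector_mult_diff_rdistrib scaleR_matrix_vector_assoc[symmetric]
          inner_diff_right)
  next
    show "(P *v cs) \<bullet> ((F - (p / q) *\<^sub>R psi P Q) *v (Q *v ct)) = 0"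
      using \<open>q \<noteq> 0\<close>
      by (simp add: matrix_vector_mult_diff_rdistrib scaleR_matrix_vector_assoc[symmetric]
          inner_diff_right flip: p_def q_def)
  qed
  ultimately show ?thesis
    unfolding proj_eq_def by (intro exI[of _ "p / q"]) simp
qed

section \<open>Projective lines, camera ranks and centers\<close>

lemma on_proj_lineI:
  assumes "x \<noteq> 0" "\<And>a. a \<in> S \<Longrightarrow> x \<bullet> a = 0"
  shows "on_proj_line S"
  unfolding on_proj_line_def using assms
  by (intro exI[of _ "{a. x \<bullet> a = 0}"]) (auto simp: subspace_hyperplane dim_hyperplane)

text \<open>The span of \<open>a\<close> and \<open>b\<close> may have dimension below two, so it is
  enlarged to a plane orthogonal to a nonzero vector.\<close>

lemma on_proj_line_span2:
  assumes "S \<subseteq> span {a, b}"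
  shows "on_proj_line S"
proof -
  have "dim {a, b} < DIM(real^3)"
    using dim_le_card'[of "{a, b}"] card_insert_le_m1[of 2 "{b}" a] by simp
  then obtain x where "x \<noteq> 0" "span {a, b} \<subseteq> {y. x \<bullet> y = 0}"
    by (metis lowdim_subset_hyperplane)
  then show ?thesis
    using assms by (intro on_proj_lineI[of x]) auto
qed

lemma camera_iff_ker: "camera P \<longleftrightarrow> (\<forall>x. (\<forall>v. x \<bullet> (P *v v) = 0) \<longrightarrow> x = 0)"
proof -
  have "camera P \<longleftrightarrow> rank (transpose P) = CARD(3)"
    by (simp add: camera_def rank_transpose)
  also have "\<dots> \<longleftrightarrow> (\<forall>x. transpose P *v x = 0 \<longrightarrow> x = 0)"
    by (metis full_rank_injective matrix_left_invertible_injective matrix_left_invertible_ker)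
  also have "\<dots> \<longleftrightarrow> (\<forall>x. (\<forall>v. x \<bullet> (P *v v) = 0) \<longrightarrow> x = 0)"
    by (metis dot_lmul_matrix transpose_matrix_vector inner_eq_zero_iff inner_zero_left)
  finally show ?thesis .
qed

lemma camera_center:
  assumes "camera P"
  obtains c where "c \<noteq> 0" "P *v c = 0"
proof -
  have "rank P \<noteq> CARD(4)"
    using assms by (simp add: camera_def)
  then show ?thesis
    by (metis full_rank_injective matrix_left_invertible_injective matrix_left_invertible_ker that)
qed

text \<open>Cameras are prescribed by their values on the standard basis; \<open>of_nat\<close> maps
  \<open>{1..4}\<close> bijectively onto the index type, sending 4 to 0.\<close>

lemma camera_columns: "\<exists>P::real^4^3. \<forall>k\<in>{1..4}. P *v axis (of_nat k) 1 = a k"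
proof -
  define P :: "real^4^3" where "P = (\<chi> r. vector [a 1 $ r, a 2 $ r, a 3 $ r, a 4 $ r])"
  have "{1..4::nat} = {1, 2, 3, 4}" by auto
  then have "\<forall>k\<in>{1..4}. P *v axis (of_nat k) 1 = a k"
    by (simp add: matrix_vector_mult_basis column_def P_def vec_eq_iff vector_def)
  then show ?thesis ..
qed


section \<open>Pairs of images and their complementary pairs\<close>

definition indices :: "nat \<Rightarrow> nat \<Rightarrow> nat \<Rightarrow> nat \<Rightarrow> bool"
  where "indices i j s t \<longleftrightarrow> distinct [i, j, s, t] \<and> {1..4} = {i, j, s, t}"

lemma indicesE:
  assumes "i \<in> {1..4}" "j \<in> {1..4}" "i \<noteq> j"
  obtains s t where "indices i j s t"
proof -
  have "card ({1..4} - {i, j}) = 2"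
    using assms by (subst card_Diff_subset) auto
  then obtain s t where st: "{1..4} - {i, j} = {s, t}" "s \<noteq> t"
    by (auto simp: card_2_iff)
  then have "{1..4} = {i, j, s, t}"
    using assms(1,2) by blast
  moreover have "distinct [i, j, s, t]"
    using st assms(3) by auto
  ultimately show ?thesis
    by (intro that[of s t]) (simp add: indices_def)
qed

lemma indicesI:
  assumes "i \<in> {1..4}" "j \<in> {1..4}" "s \<in> {1..4}" "t \<in> {1..4}" "distinct [i, j, s, t]"
  shows "indices i j s t"
proof -
  have "{i, j, s, t} = {1..4}"
    using assms by (intro card_subset_eq) auto
  then show ?thesis
    using assms(5) by (simp add: indices_def)
qed

lemma indicesD:
  assumes "indices i j s t"
  shows "i \<in> {1..4}" "j \<in> {1..4}" "s \<in> {1..4}" "t \<in> {1..4}"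
    "i \<noteq> j" "i \<noteq> s" "i \<noteq> t" "j \<noteq> s" "j \<noteq> t" "s \<noteq> t"
  using assms by (auto simp: indices_def)

lemma indices_perm:
  assumes "indices i j s t"
  shows "indices j i s t" "indices i j t s"
  using assms by (auto simp: indices_def)

section \<open>Sextuples with three non-collinear epipoles in each image\<close>

locale fundamental_sextuple =
  fixes F :: "nat \<Rightarrow> nat \<Rightarrow> real^3^3" and e :: "nat \<Rightarrow> nat \<Rightarrow> real^3"
  assumes transpose: "i \<in> {1..4} \<Longrightarrow> j \<in> {1..4} \<Longrightarrow> i \<noteq> j \<Longrightarrow> F j i = transpose (F i j)"
    and epipoles: "i \<in> {1..4} \<Longrightarrow> j \<in> {1..4} \<Longrightarrow> i \<noteq> j \<Longrightarrow> is_epipole (F i j) (e j i)"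
    and not_on_line: "i \<in> {1..4} \<Longrightarrow> \<not> on_proj_line (e i ` ({1..4} - {i}))"
begin

lemma inner_F_swap:
  assumes "i \<in> {1..4}" "j \<in> {1..4}" "i \<noteq> j"
  shows "x \<bullet> (F i j *v y) = y \<bullet> (F j i *v x)"
  unfolding transpose[OF assms]
  by (metis dot_lmul_matrix inner_commute transpose_matrix_vector)

lemma F_mult_eq_0_iff:
  assumes "i \<in> {1..4}" "j \<in> {1..4}" "i \<noteq> j"
  shows "F i j *v u = 0 \<longleftrightarrow> u \<in> span {e j i}"
  using epipoles[OF assms] by (auto simp: is_epipole_def)

lemma F_mult_epipole:
  assumes "i \<in> {1..4}" "j \<in> {1..4}" "i \<noteq> j"
  shows "F i j *v e j i = 0" "e i j \<bullet> (F i j *v y) = 0"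
proof -
  show "F i j *v e j i = 0"
    using F_mult_eq_0_iff[OF assms] by (simp add: span_base)
  have "F j i *v e i j = 0"
    using F_mult_eq_0_iff[of j i] assms by (simp add: span_base)
  then show "e i j \<bullet> (F i j *v y) = 0"
    by (simp add: inner_F_swap[OF assms])
qed

lemma image_epipoles:
  assumes "indices i j s t"
  shows "e i ` ({1..4} - {i}) = {e i j, e i s, e i t}"
proof -
  have "{1..4} - {i} = {j, s, t}"
    using assms by (auto simp: indices_def)
  then show ?thesis by simp
qed

text \<open>Non-collinear epipoles span the space. The dual form is the one that the lemmas on skew
  forms ask of image points.\<close>

lemma epipoles_complete:
  assumes "indices i j s t" "x \<bullet> e i j = 0" "x \<bullet> e i s = 0" "x \<bullet> e i t = 0"
  shows "x = 0"
proof (rule ccontr)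
  assume "x \<noteq> 0"
  then have "on_proj_line {e i j, e i s, e i t}"
    using assms(2-) by (intro on_proj_lineI) auto
  then show False
    using not_on_line indicesD(1)[OF assms(1)] by (simp only: flip: image_epipoles[OF assms(1)])
qed

lemma epipole_notin_span:
  assumes "indices i j s t"
  shows "e i j \<notin> span {e i s}"
proof
  assume "e i j \<in> span {e i s}"
  then have "e i ` ({1..4} - {i}) \<subseteq> span {e i s, e i t}"
    unfolding image_epipoles[OF assms]
    using span_mono[of "{e i s}" "{e i s, e i t}"] by (auto intro: span_base)
  then show False
    using on_proj_line_span2 not_on_line assms by (blast dest: indicesD)
qed

lemma epipole_not_proj_eq:
  assumes "i \<in> {1..4}" "j \<in> {1..4}" "k \<in> {1..4}" "i \<noteq> j" "i \<noteq> k" "j \<noteq> k"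
  shows "\<not> proj_eq (e i j) (e i k)"
proof -
  obtain s t where "indices i j s t"
    using assms(1,2,4) by (rule indicesE)
  moreover have "k = s \<or> k = t"
    using calculation assms by (auto simp: indices_def)
  ultimately have "e i j \<notin> span {e i k}"
    using epipole_notin_span indices_perm(2) by blast
  then show ?thesis
    by (auto simp: proj_eq_def span_breakdown_eq)
qed

lemma F_nonzero:
  assumes "i \<in> {1..4}" "j \<in> {1..4}" "i \<noteq> j"
  shows "F i j \<noteq> 0"
proof
  assume "F i j = 0"
  then have "u \<in> span {e j i}" for u
    using F_mult_eq_0_iff[OF assms, of u] by simp
  moreover obtain s t where "indices i j s t"
    using assms by (rule indicesE)
  then have "indices j s i t"
    by (auto simp: indices_def)
  ultimately show False
    using epipole_notin_span by blast
qed

text \<open>Epipoles in one image are pairwise distinct, which excludes the collinear alternative.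
  What remains are the three epipolar equations, all of one shape up to renaming indices.\<close>

lemma triple_wise_iff:
  "(\<forall>i\<in>{1..4}. \<forall>j\<in>{1..4}. \<forall>k\<in>{1..4}. i \<noteq> j \<and> i \<noteq> k \<and> j \<noteq> k \<longrightarrow> triple_wise F e i j k) \<longleftrightarrow>
    (\<forall>i\<in>{1..4}. \<forall>j\<in>{1..4}. \<forall>k\<in>{1..4}. i \<noteq> j \<and> i \<noteq> k \<and> j \<noteq> k \<longrightarrow> epi F e k i j k = 0)"
  (is "?L \<longleftrightarrow> ?R")
proof
  assume ?L
  then show ?R
    unfolding triple_wise_def triple_collinear_def triple_noncollinear_def epi_def
    using epipole_not_proj_eq by blast
next
  assume R: ?R
  show ?L
    unfolding triple_wise_def triple_noncollinear_def
    using R[unfolded epi_def] epipole_not_proj_eq by metis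
qed

text \<open>Otherwise \<open>F i j *v e j t\<close> would be orthogonal to all three epipoles in
  image \<open>i\<close>, so \<open>e j t\<close> would lie in the kernel spanned by
  \<open>e j i\<close>. This permits division in the cyclic system.\<close>

lemma epi_nonzero:
  assumes "indices i j s t" "epi F e t i j t = 0"
  shows "epi F e s i j t \<noteq> 0"
proof
  assume "epi F e s i j t = 0"
  then have "F i j *v e j t = 0"
    using assms F_mult_epipole(2)[of i j "e j t"] indicesD[OF assms(1)]
    by (intro epipoles_complete[OF assms(1)]) (auto simp: epi_def inner_commute)
  then have "e j t \<in> span {e j i}"
    using F_mult_eq_0_iff indicesD[OF assms(1)] by blast
  moreover have "indices j t i s"
    using assms(1) by (auto simp: indices_def)
  ultimately show False
    using epipole_notin_span by blast
qed

section \<open>Necessity: epipoles as images of the centers\<close>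

text \<open>\<open>B i j s t\<close> is the form of \<open>F i j\<close> on the images of the
  centers \<open>c s\<close> and \<open>c t\<close>; \<open>\<nu> j i\<close> rescales the image of
  \<open>c i\<close> under \<open>P j\<close> to the chosen epipole.\<close>

lemma compatible_imp_skew_epi:
  assumes "compatible 4 F"
  obtains \<nu> :: "nat \<Rightarrow> nat \<Rightarrow> real" and B :: "nat \<Rightarrow> nat \<Rightarrow> nat \<Rightarrow> nat \<Rightarrow> real" where
    "\<And>i j s t. {i, j, s, t} \<subseteq> {1..4} \<Longrightarrow> i \<noteq> j \<Longrightarrow> s \<noteq> i \<Longrightarrow> t \<noteq> j \<Longrightarrow>
      epi F e s i j t = \<nu> i s * \<nu> j t * B i j s t"
    "\<And>i j s t. {i, j} \<subseteq> {1..4} \<Longrightarrow> i \<noteq> j \<Longrightarrow> B i j s t = - B i j t s"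
proof -
  obtain P where P: "\<And>i. i \<in> {1..4} \<Longrightarrow> camera (P i)"
    and psi: "\<And>i j. i \<in> {1..4} \<Longrightarrow> j \<in> {1..4} \<Longrightarrow> i < j \<Longrightarrow> proj_eq (F i j) (psi (P i) (P j))"
    using assms unfolding compatible_def by blast
  have "\<exists>c. \<forall>i\<in>{1..4}. c i \<noteq> 0 \<and> P i *v c i = 0"
    by (meson P camera_center)
  then obtain c where c: "\<And>i. i \<in> {1..4} \<Longrightarrow> c i \<noteq> 0" "\<And>i. i \<in> {1..4} \<Longrightarrow> P i *v c i = 0"
    by blast
  have skew_less: "(P i *v v) \<bullet> (F i j *v (P j *v w)) = - ((P i *v w) \<bullet> (F i j *v (P j *v v)))"
    if "i \<in> {1..4}" "j \<in> {1..4}" "i < j" for i j v w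
    using psi[OF that] psi_skew[of "P i" v "P j" w]
    by (auto simp: proj_eq_def scaleR_matrix_vector_assoc[symmetric])
  have skew: "(P i *v v) \<bullet> (F i j *v (P j *v w)) = - ((P i *v w) \<bullet> (F i j *v (P j *v v)))"
    if "i \<in> {1..4}" "j \<in> {1..4}" "i \<noteq> j" for i j v w
    using skew_less[of i j v w] skew_less[of j i v w] inner_F_swap[OF that] that
    by (cases "i < j") (auto simp: not_less)
  \<comment> \<open>If \<open>P j\<close> also killed \<open>c i\<close>, the two cameras would
    share a center and \<open>F i j\<close> would be zero.\<close>
  have center: "P j *v c i \<noteq> 0" if "i \<in> {1..4}" "j \<in> {1..4}" "i \<noteq> j" for i j
  proof
    assume "P j *v c i = 0"
    then have "psi (P i) (P j) = 0" "psi (P j) (P i) = 0"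
      using c that by (auto intro: psi_eq_0)
    then show False
      using psi[of i j] psi[of j i] F_nonzero[of i j] F_nonzero[of j i] that
      by (cases "i < j") (auto simp: proj_eq_def not_less)
  qed
  define \<nu> where "\<nu> j i = (SOME \<nu>. e j i = \<nu> *\<^sub>R (P j *v c i))" for i j
  have ex: "\<exists>\<nu>. e j i = \<nu> *\<^sub>R (P j *v c i)" if ij: "i \<in> {1..4}" "j \<in> {1..4}" "i \<noteq> j" for i j
  proof -
    \<comment> \<open>Skewness moves the form onto \<open>P i *v c i = 0\<close>. Since
      \<open>P i\<close> has rank three, \<open>F i j\<close> kills the image of \<open>c i\<close>,
      which is therefore the epipole.\<close>
    have "(F i j *v (P j *v c i)) \<bullet> (P i *v v) = 0" for v
      using skew[OF ij, of v "c i"] c(2)[OF ij(1)] by (simp add: inner_commute)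
    then have "F i j *v (P j *v c i) = 0"
      using P[OF ij(1)] by (simp add: camera_iff_ker)
    then have "P j *v c i \<in> span {e j i}"
      by (simp add: F_mult_eq_0_iff[OF ij])
    then obtain k where k: "P j *v c i = k *\<^sub>R e j i"
      by (auto simp: span_breakdown_eq)
    then have "k \<noteq> 0"
      using center[OF ij] by auto
    then show ?thesis
      unfolding k by (intro exI[of _ "1 / k"]) simp
  qed
  have \<nu>: "e j i = \<nu> j i *\<^sub>R (P j *v c i)" if "i \<in> {1..4}" "j \<in> {1..4}" "i \<noteq> j" for i j
    unfolding \<nu>_def by (rule someI_ex[OF ex[OF that]])
  show ?thesis
  proof
    show "epi F e s i j t = \<nu> i s * \<nu> j t * ((P i *v c s) \<bullet> (F i j *v (P j *v c t)))"
      if "{i, j, s, t} \<subseteq> {1..4}" "i \<noteq> j" "s \<noteq> i" "t \<noteq> j" for i j s t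
    proof -
      have "e i s = \<nu> i s *\<^sub>R (P i *v c s)" "e j t = \<nu> j t *\<^sub>R (P j *v c t)"
        by (rule \<nu>; use that in auto)+
      then show ?thesis
        by (simp only: epi_def matrix_vector_mult_scaleR inner_scaleR_left inner_scaleR_right
            real_scaleR_def mult.assoc) simp
    qed
    show "(P i *v c s) \<bullet> (F i j *v (P j *v c t)) = - ((P i *v c t) \<bullet> (F i j *v (P j *v c s)))"
      if "{i, j} \<subseteq> {1..4}" "i \<noteq> j" for i j s t
      by (rule skew; use that in auto)
  qed
qed

section \<open>Sufficiency: cameras with scaled epipoles as columns\<close>

lemma compatible_if_scaled_epi_skew:
  assumes triple: "\<And>i j k. {i, j, k} \<subseteq> {1..4} \<Longrightarrow> distinct [i, j, k] \<Longrightarrow> epi F e k i j k = 0"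
    and nz: "\<And>i j. \<mu> i j \<noteq> 0"
    and skew: "\<And>i j s t. indices i j s t \<Longrightarrow> i < j \<Longrightarrow> s < t \<Longrightarrow>
      \<mu> i s * \<mu> j t * epi F e s i j t = - (\<mu> i t * \<mu> j s * epi F e t i j s)"
  shows "compatible 4 F"
proof -
  \<comment> \<open>The zero column makes the \<open>i\<close>-th coordinate axis the center of
    \<open>P i\<close>.\<close>
  define a where "a = (\<lambda>i k. if k = i then 0 else \<mu> i k *\<^sub>R e i k)"
  obtain P :: "nat \<Rightarrow> real^4^3"
    where P: "\<And>i k. k \<in> {1..4} \<Longrightarrow> P i *v axis (of_nat k) 1 = a i k"
    using camera_columns[of "a _"] by metis
  have complete: "x = 0"
    if "indices i j s t" "x \<bullet> a i j = 0" "x \<bullet> a i s = 0" "x \<bullet> a i t = 0" for x i j s t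
    using that(2-) nz indicesD[OF that(1)] epipoles_complete[OF that(1), of x] by (auto simp: a_def)
  have "camera (P i)" if i: "i \<in> {1..4}" for i
    unfolding camera_iff_ker
  proof (intro allI impI)
    fix x assume x: "\<forall>v. x \<bullet> (P i *v v) = 0"
    obtain j :: nat where "j \<in> {1..4}" "i \<noteq> j"
      using that by (cases "i = 1") (auto intro: that[of 1] that[of 2])
    then obtain s t where ix: "indices i j s t"
      using i by (rule_tac indicesE)
    show "x = 0"
      using P x indicesD[OF ix] by (intro complete[OF ix]) metis+
  qed
  moreover have "proj_eq (F i j) (psi (P i) (P j))"
    if ij: "i \<in> {1..4}" "j \<in> {1..4}" "i < j" for i j
  proof -
    obtain s t where ix: "indices i j s t"
      using ij by (metis indicesE less_irrefl)
    note d = indicesD[OF ix]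
    note Pd = d(1-4)[THEN P]
    have st: "a i s \<bullet> (F i j *v a j t) = - (a i t \<bullet> (F i j *v a j s))"
      using skew[OF ix ij(3)] skew[OF indices_perm(2)[OF ix] ij(3)] d
      by (cases "s < t") (auto simp: a_def epi_def matrix_vector_mult_scaleR algebra_simps)
    have tt: "a i k \<bullet> (F i j *v a j k) = 0" if "k \<in> {i, j, s, t}" for k
      using that triple[of i j k] d by (auto simp: a_def epi_def matrix_vector_mult_scaleR)
    have zero: "F i j *v a j i = 0" "a i j \<bullet> (F i j *v y) = 0" "a i i = 0" "a j j = 0" for y
      using F_mult_epipole[OF d(1,2,5)] d by (auto simp: a_def matrix_vector_mult_scaleR)
    \<comment> \<open>If \<open>k\<close> or \<open>l\<close> is \<open>i\<close> or
      \<open>j\<close>, both sides vanish; equal indices are covered by \<open>tt\<close>, so only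
      \<open>s\<close> and \<open>t\<close> in either order remain.\<close>
    have sk: "a i k \<bullet> (F i j *v a j l) = - (a i l \<bullet> (F i j *v a j k))"
      if "k \<in> {i, j, s, t}" "l \<in> {i, j, s, t}" for k l
      using that st tt zero by (auto simp: tt)
    show ?thesis
    proof (rule skew_form_proj_eq_psi[where ci = "axis (of_nat i) 1" and cj = "axis (of_nat j) 1"
          and cs = "axis (of_nat s) 1" and ct = "axis (of_nat t) 1"], goal_cases)
      case (1 v w)
      then obtain k l where "k \<in> {i, j, s, t}" "v = axis (of_nat k) 1"
        "l \<in> {i, j, s, t}" "w = axis (of_nat l) 1"
        by blast
      moreover have "{i, j, s, t} = {1..4}"
        using ix by (simp add: indices_def)
      ultimately show ?case
        using sk[of k l] P by (metis (no_types))
    next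
      case (4 x)
      then show ?case
        using 4 complete[OF ix, of x] by (simp add: Pd)
    next
      case (5 x)
      then show ?case
        using 5 complete[OF indices_perm(1)[OF ix], of x] by (simp add: Pd)
    qed (use F_nonzero d zero in \<open>auto simp: Pd\<close>)
  qed
  ultimately show ?thesis
    unfolding compatible_def by blast
qed

end

section \<open>The cyclic system for the scale factors and the equivalence\<close>

text \<open>The equations link the unknowns in the cycle \<open>x1\<close>, \<open>x2\<close>,
  \<open>x4\<close>, \<open>x3\<close>, \<open>x5\<close>, \<open>x6\<close>. Six signs cancel
  around it, so the product identity closes it. With \<open>x1 = 1\<close>, the first equation gives
  \<open>x2\<close>; the others follow backwards along the cycle through \<open>x6\<close>,
  \<open>x5\<close>, \<open>x3\<close>, \<open>x4\<close>.\<close>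

lemma cyclic_system_solvable:
  fixes a1 a2 a3 a4 a5 a6 b1 b2 b3 b4 b5 b6 :: real
  assumes "a1 \<noteq> 0" "a2 \<noteq> 0" "a3 \<noteq> 0" "a4 \<noteq> 0" "a5 \<noteq> 0" "a6 \<noteq> 0"
    and "b1 \<noteq> 0" "b2 \<noteq> 0" "b3 \<noteq> 0" "b4 \<noteq> 0" "b5 \<noteq> 0" "b6 \<noteq> 0"
    and "a1 * a2 * a3 * a4 * a5 * a6 = b1 * b2 * b3 * b4 * b5 * b6"
  obtains x1 x2 x3 x4 x5 x6 where
    "x1 \<noteq> 0" "x2 \<noteq> 0" "x3 \<noteq> 0" "x4 \<noteq> 0" "x5 \<noteq> 0" "x6 \<noteq> 0"
    "x1 * a1 = - (x2 * b1)" "x4 * a2 = - (x3 * b2)" "x5 * a3 = - (x6 * b3)"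
    "x2 * a4 = - (x4 * b4)" "x6 * a5 = - (x1 * b5)" "x3 * a6 = - (x5 * b6)"
proof
  \<comment> \<open>The link between \<open>x2\<close> and \<open>x4\<close> closes the cycle and
    carries the product identity.\<close>
  show "- (a1 / b1) * a4 = - (b2 * b3 * b5 * b6 / (a2 * a3 * a5 * a6) * b4)"
    using assms by (simp add: field_simps)
  show "1 * a1 = - (- (a1 / b1) * b1)"
    "b2 * b3 * b5 * b6 / (a2 * a3 * a5 * a6) * a2 = - (- (b3 * b5 * b6 / (a3 * a5 * a6)) * b2)"
    "b3 * b5 / (a3 * a5) * a3 = - (- (b5 / a5) * b3)"
    "- (b5 / a5) * a5 = - (1 * b5)"
    "- (b3 * b5 * b6 / (a3 * a5 * a6)) * a6 = - (b3 * b5 / (a3 * a5) * b6)"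
    using assms(1-12) by (simp_all add: field_simps)
qed (use assms in auto)

theorem theorem3p8:
  fixes F :: "nat \<Rightarrow> nat \<Rightarrow> real^3^3" and e :: "nat \<Rightarrow> nat \<Rightarrow> real^3"
  assumes fundamental: "\<And>i j. i \<in> {1..4} \<Longrightarrow> j \<in> {1..4} \<Longrightarrow> i < j \<Longrightarrow> fundamental (F i j)"
    and transpose: "\<And>i j. i \<in> {1..4} \<Longrightarrow> j \<in> {1..4} \<Longrightarrow> i < j \<Longrightarrow> F j i = transpose (F i j)"
    and epipoles: "\<And>i j. i \<in> {1..4} \<Longrightarrow> j \<in> {1..4} \<Longrightarrow> i \<noteq> j \<Longrightarrow> is_epipole (F i j) (e j i)"
    and not_on_line: "\<And>i. i \<in> {1..4} \<Longrightarrow> \<not> on_proj_line (e i ` ({1..4} - {i}))"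
  shows "compatible 4 F \<longleftrightarrow>
    (\<forall>i\<in>{1..4}. \<forall>j\<in>{1..4}. \<forall>k\<in>{1..4}. i \<noteq> j \<and> i \<noteq> k \<and> j \<noteq> k \<longrightarrow> triple_wise F e i j k) \<and>
    epi F e 4 1 2 3 * epi F e 2 1 3 4 * epi F e 3 1 4 2 *
    epi F e 4 2 3 1 * epi F e 1 2 4 3 * epi F e 2 3 4 1 =
    epi F e 3 1 2 4 * epi F e 4 1 3 2 * epi F e 2 1 4 3 *
    epi F e 1 2 3 4 * epi F e 3 2 4 1 * epi F e 1 3 4 2"
proof -
  interpret fundamental_sextuple F e
  proof
    show "F j i = transpose (F i j)" if "i \<in> {1..4}" "j \<in> {1..4}" "i \<noteq> j" for i j
      using transpose[of i j] transpose[of j i] that by (cases "i < j") auto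
  qed (use epipoles not_on_line in auto)
  show ?thesis (is "_ \<longleftrightarrow> _ \<and> ?E")
    unfolding triple_wise_iff
  proof (intro iffI)
    assume "compatible 4 F"
    then obtain \<nu> B where epi: "\<And>i j s t. {i, j, s, t} \<subseteq> {1..4} \<Longrightarrow> i \<noteq> j \<Longrightarrow> s \<noteq> i \<Longrightarrow> t \<noteq> j \<Longrightarrow>
        epi F e s i j t = \<nu> i s * \<nu> j t * B i j s t"
      and B: "\<And>i j s t. {i, j} \<subseteq> {1..4} \<Longrightarrow> i \<noteq> j \<Longrightarrow> B i j s t = - B i j t s"
      by (rule compatible_imp_skew_epi) blast
    have "epi F e k i j k = 0" if "i \<in> {1..4}" "j \<in> {1..4}" "k \<in> {1..4}" "i \<noteq> j \<and> i \<noteq> k \<and> j \<noteq> k" for i j k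
      using epi[of i j k k] B[of i j k k] that by auto
    moreover have ?E
      \<comment> \<open>Each of the twelve factors \<open>\<nu> i s\<close> with distinct indices in
        \<open>{1..4}\<close> occurs once on either side, and the six sign changes from
        \<open>B\<close> multiply to 1.\<close>
      using B[of 1 2 4 3] B[of 1 3 2 4] B[of 1 4 3 2] B[of 2 3 4 1] B[of 2 4 1 3] B[of 3 4 2 1]
      by (simp add: epi)
    ultimately show "(\<forall>i\<in>{1..4}. \<forall>j\<in>{1..4}. \<forall>k\<in>{1..4}. i \<noteq> j \<and> i \<noteq> k \<and> j \<noteq> k \<longrightarrow>
        epi F e k i j k = 0) \<and> ?E"
      by blast
  next
    assume *: "(\<forall>i\<in>{1..4}. \<forall>j\<in>{1..4}. \<forall>k\<in>{1..4}. i \<noteq> j \<and> i \<noteq> k \<and> j \<noteq> k \<longrightarrow>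
        epi F e k i j k = 0) \<and> ?E"
    then have triple: "epi F e k i j k = 0" if "{i, j, k} \<subseteq> {1..4}" "distinct [i, j, k]" for i j k
      using that by simp
    have nz: "epi F e s i j t \<noteq> 0" if "{i, j, s, t} \<subseteq> {1..4}" "distinct [i, j, s, t]" for i j s t
      using that by (intro epi_nonzero indicesI triple) auto
    obtain x23 x24 x32 x34 x42 x43 where x:
      "x23 \<noteq> 0" "x24 \<noteq> 0" "x32 \<noteq> 0" "x34 \<noteq> 0" "x42 \<noteq> 0" "x43 \<noteq> 0"
      "x23 * epi F e 4 1 2 3 = - (x24 * epi F e 3 1 2 4)"
      "x34 * epi F e 2 1 3 4 = - (x32 * epi F e 4 1 3 2)"
      "x42 * epi F e 3 1 4 2 = - (x43 * epi F e 2 1 4 3)"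
      "x24 * epi F e 4 2 3 1 = - (x34 * epi F e 1 2 3 4)"
      "x43 * epi F e 1 2 4 3 = - (x23 * epi F e 3 2 4 1)"
      "x32 * epi F e 2 3 4 1 = - (x42 * epi F e 1 3 4 2)"
      by (rule cyclic_system_solvable[OF _ _ _ _ _ _ _ _ _ _ _ _ conjunct2[OF *]]) (simp_all add: nz)
    \<comment> \<open>The default 1 is the normalization for pairs containing the index 1.
      Elsewhere, as on the diagonal, it only keeps \<open>\<mu>\<close> nonzero.\<close>
    define \<mu> :: "nat \<Rightarrow> nat \<Rightarrow> real" where "\<mu> i j =
      (if i = 2 \<and> j = 3 then x23 else if i = 2 \<and> j = 4 then x24 else
       if i = 3 \<and> j = 2 then x32 else if i = 3 \<and> j = 4 then x34 else
       if i = 4 \<and> j = 2 then x42 else if i = 4 \<and> j = 3 then x43 else 1)" for i j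
    show "compatible 4 F"
    proof (rule compatible_if_scaled_epi_skew[where \<mu> = \<mu>])
      fix i j s t :: nat
      assume ix: "indices i j s t" "i < j" "s < t"
      have n: "n = 1 \<or> n = 2 \<or> n = 3 \<or> n = 4" if "n \<in> {1..4}" for n :: nat
        using that by auto
      have "i = 1 \<and> j = 2 \<and> s = 3 \<and> t = 4 \<or> i = 1 \<and> j = 3 \<and> s = 2 \<and> t = 4 \<or>
          i = 1 \<and> j = 4 \<and> s = 2 \<and> t = 3 \<or> i = 2 \<and> j = 3 \<and> s = 1 \<and> t = 4 \<or>
          i = 2 \<and> j = 4 \<and> s = 1 \<and> t = 3 \<or> i = 3 \<and> j = 4 \<and> s = 1 \<and> t = 2"
        using indicesD(1-4)[OF ix(1), THEN n] ix(2,3) indicesD(5-)[OF ix(1)]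
        by (elim disjE) simp_all
      then show "\<mu> i s * \<mu> j t * epi F e s i j t = - (\<mu> i t * \<mu> j s * epi F e t i j s)"
        using x(7-) by (elim disjE) (auto simp: \<mu>_def)
    qed (use triple x in \<open>auto simp: \<mu>_def\<close>)
  qed
qed

end
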